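(* Let $G_4=(V,E)$ be a finite digraph whose vertex set is partitioned as $V=V_1\cup W_1$ with $V_1\cap W_1=\varnothing$, $V_1=\{v_1,\dots,v_n\}$, $W_1=\{w_1,\dots,w_m\}$, such that for every $v\in V_1$ and every $w\in W_1$ there is exactly one directed edge $(v,w)\in E$, and $d_{\mathrm{out}}(w)=0$ for every $w\in W_1$. Suppose $m=|W_1|$ is even. Consider the auxiliary impartial game (normal play) whose positions are tuples $(x_1,\dots,x_n)$ of non-negative integers (tokens on $v_1,\dots,v_n$), in which a move consists of choosing some $v_i\in V_1$, removing at least $d_{\mathrm{out}}(v_i)+1$ tokens from $v_i$, where $d_{\mathrm{out}}(v_i)$ is the out-degree of $v_i$ in $G_4$ (counting its out-neighbours in both $V_1$ and $W_1$), and adding one token to each $v_j\in V_1$ with $(v_i,v_j)\in E$ (no tokens are placed on or removed from vertices of $W_1$). Let $S_{\mathcal P}$ and $S_{\mathcal N}$ be the sets of $\mathcal{P}$-positions and $\mathcal{N}$-positions of this auxiliary game. Then, for Digraph Yama Nim on $G_4$ with positions written as $(x_1,\dots,x_n,y_1,\dots,y_m)$ ($x_i$ tokens on $v_i$, $y_j$ tokens on $w_j$), the set of $\mathcal{P}$-positions is $S_1\cup S_2$, where $$S_1=\{(x_1,\dots,x_n,y_1,\dots,y_m)\mid (x_1,\dots,x_n)\in S_{\mathcal P}\text{ and } y_1\oplus\cdots\oplus y_m=0\},$$ $$S_2=\{(x_1,\dots,x_n,y_1,\dots,y_m)\mid (x_1,\dots,x_n)\in S_{\mathcal N}\text{ and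 } y_1\oplus\cdots\oplus y_m=1\}.$$
   Context: Digraph Yama Nim on a finite digraph $G=(V,E)$: a position assigns a non-negative integer number of tokens to each vertex. On a turn, a player chooses a vertex $v$ and removes at least $d_{\mathrm{out}}(v)+1$ tokens from $v$ (where $d_{\mathrm{out}}(v)$ is the out-degree of $v$), and simultaneously adds one token to each out-neighbour of $v$; other counts are unchanged. Normal play: the player making the last move wins. A $\mathcal{P}$-position is one where the previous player has a winning strategy; an $\mathcal{N}$-position is one where the player to move has a winning strategy. $\oplus$ denotes bitwise XOR (nim-sum). *)

theory Defs
  imports "HOL-Library.FuncSet" "Graph_Theory.Graph_Theory"
begin

section \<open>Impartial games under normal play\<close>

text \<open>
  A game is given by its move relation \<open>mv\<close>, and a strategy \<open>\<sigma>\<close> maps a position to the position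
  its owner moves to. \<open>mover_wins mv \<sigma> p\<close> says that the player to move at \<open>p\<close>, following \<open>\<sigma>\<close>,
  makes the last move whatever the opponent does; \<open>previous_wins mv \<sigma> p\<close> says the same of the
  player who has just moved. A player who is to move and has no legal move has lost: this is the
  vacuous case of \<open>previous\<close>. As the definition is inductive, \<open>\<sigma>\<close> has to win after finitely many
  moves against every line of play.
\<close>

inductive mover_wins previous_wins :: "('p \<Rightarrow> 'p \<Rightarrow> bool) \<Rightarrow> ('p \<Rightarrow> 'p) \<Rightarrow> 'p \<Rightarrow> bool"
  for mv :: "'p \<Rightarrow> 'p \<Rightarrow> bool" and \<sigma> :: "'p \<Rightarrow> 'p"
  where
    mover: "mv p (\<sigma> p) \<Longrightarrow> previous_wins mv \<sigma> (\<sigma> p) \<Longrightarrow> mover_wins mv \<sigma> p"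
  | previous: "(\<And>q. mv p q \<Longrightarrow> mover_wins mv \<sigma> q) \<Longrightarrow> previous_wins mv \<sigma> p"

definition P_positions :: "'p set \<Rightarrow> ('p \<Rightarrow> 'p \<Rightarrow> bool) \<Rightarrow> 'p set" where
  "P_positions X mv = {p \<in> X. \<exists>\<sigma>. previous_wins mv \<sigma> p}"

definition N_positions :: "'p set \<Rightarrow> ('p \<Rightarrow> 'p \<Rightarrow> bool) \<Rightarrow> 'p set" where
  "N_positions X mv = {p \<in> X. \<exists>\<sigma>. mover_wins mv \<sigma> p}"

section \<open>Digraph Yama Nim\<close>

text \<open>
  A position with tokens on the vertices in \<open>U\<close> is a function in \<open>U \<rightarrow>\<^sub>E UNIV\<close>, that is, a tuple of
  natural numbers indexed by \<open>U\<close>.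
\<close>

abbreviation positions :: "'a set \<Rightarrow> ('a \<Rightarrow> nat) set" where
  "positions U \<equiv> U \<rightarrow>\<^sub>E UNIV"

text \<open>
  The game restricted to a set \<open>U\<close> of vertices: tokens are removed from and added to vertices in
  \<open>U\<close> only, but the out-degree is still taken in the whole digraph \<open>G\<close>. Digraph Yama Nim on \<open>G\<close>
  is the case \<open>U = pverts G\<close>. A vertex carrying a loop is one of its own out-neighbours.
\<close>

definition yama_move_on ::
  "'a pair_pre_digraph \<Rightarrow> 'a set \<Rightarrow> ('a \<Rightarrow> nat) \<Rightarrow> ('a \<Rightarrow> nat) \<Rightarrow> bool" where
  "yama_move_on G U p q \<longleftrightarrow>
     (\<exists>v\<in>U. \<exists>k. out_degree (with_proj G) v + 1 \<le> k \<and> k \<le> p v \<and>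
        q = (\<lambda>u\<in>U. (if u = v then p u - k else p u) + (if (v, u) \<in> parcs G then 1 else 0)))"

definition yama_move :: "'a pair_pre_digraph \<Rightarrow> ('a \<Rightarrow> nat) \<Rightarrow> ('a \<Rightarrow> nat) \<Rightarrow> bool" where
  "yama_move G = yama_move_on G (pverts G)"

definition nim_sum :: "('a \<Rightarrow> nat) \<Rightarrow> 'a set \<Rightarrow> nat" where
  "nim_sum = comm_monoid_set.F xor 0"

lemma comm_monoid_set_xor: "comm_monoid_set (xor :: nat \<Rightarrow> nat \<Rightarrow> nat) 0"
  by unfold_locales

lemma nim_sum_empty: "nim_sum y {} = 0"
  unfolding nim_sum_def by (rule comm_monoid_set.empty[OF comm_monoid_set_xor])

lemma nim_sum_insert:
  "finite A \<Longrightarrow> a \<notin> A \<Longrightarrow> nim_sum y (insert a A) = xor (y a) (nim_sum y A)"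
  unfolding nim_sum_def by (rule comm_monoid_set.insert[OF comm_monoid_set_xor])

end

theory Submission
  imports Defs
begin

text \<open>
  Both games terminate, so it suffices to check that the claimed set is a kernel of the move graph:
  no move joins two of its members, and every position outside it has a move into it.
  Moves inside \<open>W1\<close> are ordinary Nim moves, while a move inside \<open>V1\<close> adds one token to every
  vertex of \<open>W1\<close>. Adding one to each of an even number of heaps preserves the parity of the nim-sum
  and, when the nim-sum is odd, flips its bit 1; so it leads from nim-sum 0 to an even one and
  from nim-sum 1 to one that is at least 2. Finally, from nim-sum 0 with an \<open>\<N>\<close>-position on \<open>V1\<close>
  one either decrements an odd heap, reaching nim-sum 1, or all heaps are even, and then adding one
  to each of them preserves the nim-sum, so that a winning move of the auxiliary game wins.
\<close>

section \<open>Kernels of terminating games\<close>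

definition is_kernel :: "'p set \<Rightarrow> ('p \<Rightarrow> 'p \<Rightarrow> bool) \<Rightarrow> 'p set \<Rightarrow> bool" where
  "is_kernel X mv K \<longleftrightarrow> K \<subseteq> X \<and> (\<forall>p\<in>K. \<forall>q. mv p q \<longrightarrow> q \<notin> K) \<and> (\<forall>p\<in>X - K. \<exists>q\<in>K. mv p q)"

text \<open>Let \<open>\<sigma>\<close> and \<open>\<tau>\<close> play each other: after one move
  the two claims swap roles, so the induction on the derivation for \<open>\<sigma>\<close> ends in
  a player without a move.\<close>

lemma mover_wins_not_previous_wins:
  "mover_wins mv \<sigma> p \<Longrightarrow> \<not> previous_wins mv \<tau> p"
  "previous_wins mv \<sigma> p \<Longrightarrow> \<not> mover_wins mv \<tau> p"
proof (induction rule: mover_wins_previous_wins.inducts)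
  case (mover p)
  then show ?case
    by (metis previous_wins.cases)
next
  case (previous p)
  then show ?case
    by (metis mover_wins.cases)
qed

lemma kernel_wins:
  assumes wf: "wf {(q, p). mv p q}"
    and closed: "\<forall>p\<in>X. \<forall>q. mv p q \<longrightarrow> q \<in> X"
    and K: "is_kernel X mv K"
  obtains \<sigma> where "\<And>p. p \<in> K \<Longrightarrow> previous_wins mv \<sigma> p"
    and "\<And>p. p \<in> X - K \<Longrightarrow> mover_wins mv \<sigma> p"
proof -
  \<comment> \<open>Always move into \<open>K\<close>. The choice is meaningful only on
    \<open>X - K\<close>, the only place where \<open>\<sigma>\<close> is consulted.\<close>
  define \<sigma> where "\<sigma> p = (SOME q. q \<in> K \<and> mv p q)" for p
  have \<sigma>: "\<sigma> p \<in> K \<and> mv p (\<sigma> p)" if "p \<in> X - K" for p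
    unfolding \<sigma>_def by (rule someI_ex) (use K that in \<open>auto simp: is_kernel_def\<close>)
  have "(p \<in> K \<longrightarrow> previous_wins mv \<sigma> p) \<and> (p \<in> X - K \<longrightarrow> mover_wins mv \<sigma> p)" for p
  proof (induction p rule: wf_induct_rule[OF wf])
    case (1 p)
    have "previous_wins mv \<sigma> p" if "p \<in> K"
    proof (rule previous)
      fix q assume "mv p q"
      with that K closed have "q \<in> X - K"
        by (auto simp: is_kernel_def)
      with 1 \<open>mv p q\<close> show "mover_wins mv \<sigma> q"
        by auto
    qed
    moreover have "mover_wins mv \<sigma> p" if "p \<in> X - K"
      using \<sigma>[OF that] 1 by (auto intro: mover)
    ultimately show ?case
      by blast
  qed
  then show thesis
    using that by blast
qed

lemma
  assumes "wf {(q, p). mv p q}"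
    and "\<forall>p\<in>X. \<forall>q. mv p q \<longrightarrow> q \<in> X"
    and K: "is_kernel X mv K"
  shows P_positions_kernel: "P_positions X mv = K"
    and N_positions_kernel: "N_positions X mv = X - K"
proof -
  obtain \<sigma> where \<sigma>: "\<And>p. p \<in> K \<Longrightarrow> previous_wins mv \<sigma> p"
    "\<And>p. p \<in> X - K \<Longrightarrow> mover_wins mv \<sigma> p"
    using kernel_wins[OF assms] by blast
  have "K \<subseteq> X"
    using K by (simp add: is_kernel_def)
  with \<sigma> show "P_positions X mv = K" "N_positions X mv = X - K"
    unfolding P_positions_def N_positions_def
    using mover_wins_not_previous_wins[of mv] by blast+
qed

text \<open>The usual recursion, that no option is losing, is not monotone. Unfolding it over two
  moves leaves only a positive occurrence.\<close>

inductive losing :: "('p \<Rightarrow> 'p \<Rightarrow> bool) \<Rightarrow> 'p \<Rightarrow> bool" for mv where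
  "(\<And>q. mv p q \<Longrightarrow> \<exists>r. mv q r \<and> losing mv r) \<Longrightarrow> losing mv p"

text \<open>Recovers the one-move recursion; on a cycle of two positions it would fail, hence the
  well-foundedness.\<close>

lemma losing_iff:
  assumes "wf {(q, p). mv p q}"
  shows "losing mv p \<longleftrightarrow> (\<forall>q. mv p q \<longrightarrow> \<not> losing mv q)"
proof (induction p rule: wf_induct_rule[OF assms])
  case (1 p)
  then show ?case
    by (subst losing.simps) blast
qed

text \<open>Serves the auxiliary game, whose losing positions have no explicit description.\<close>

lemma ex_kernel:
  assumes wf: "wf {(q, p). mv p q}"
    and closed: "\<forall>p\<in>X. \<forall>q. mv p q \<longrightarrow> q \<in> X"
  shows "\<exists>K. is_kernel X mv K"
proof -
  have "is_kernel X mv {p \<in> X. losing mv p}"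
    unfolding is_kernel_def using losing_iff[OF wf] closed by blast
  then show ?thesis ..
qed

section \<open>Nim-sums\<close>

lemma nim_sum_cong:
  "(\<And>a. a \<in> A \<Longrightarrow> y a = z a) \<Longrightarrow> nim_sum y A = nim_sum z A"
  unfolding nim_sum_def by (rule comm_monoid_set.cong[OF comm_monoid_set_xor]) auto

lemma nim_sum_update:
  assumes "finite A" "a \<in> A"
  shows "nim_sum (y(a := n)) A = xor (nim_sum y A) (xor (y a) n)"
proof -
  obtain B where B: "A = insert a B" "a \<notin> B" "finite B"
    using assms by (metis finite_insert mk_disjoint_insert)
  have "nim_sum (y(a := n)) B = nim_sum y B"
    by (rule nim_sum_cong) (use B in auto)
  then show ?thesis
    using B by (simp add: nim_sum_insert bit_eq_iff bit_xor_iff) blast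
qed

lemma nim_sum_update_neq:
  assumes "finite A" "a \<in> A" "n \<noteq> y a"
  shows "nim_sum (y(a := n)) A \<noteq> nim_sum y A"
proof
  assume "nim_sum (y(a := n)) A = nim_sum y A"
  then have "n = y a"
    unfolding nim_sum_update[OF assms(1,2)]
    by (auto simp: bit_eq_iff bit_xor_iff)
  with assms show False
    by simp
qed

lemma bit_Suc_nat_1: "bit (Suc n) 1 \<longleftrightarrow> (bit n 1 \<noteq> odd n)"
  by (simp add: bit_iff_odd) presburger

text \<open>Every heap flips bit 0. Bit 1 receives a carry exactly from the odd heaps, and the
  parity of their number is bit 0 of the nim-sum.\<close>

lemma nim_sum_Suc_low_bits:
  assumes "finite A"
  shows "even (nim_sum (\<lambda>a. Suc (y a)) A) \<longleftrightarrow> (even (nim_sum y A) \<longleftrightarrow> even (card A))"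
    and "bit (nim_sum (\<lambda>a. Suc (y a)) A) 1 \<longleftrightarrow> (bit (nim_sum y A) 1 \<noteq> odd (nim_sum y A))"
  using assms
proof (induction A)
  case empty
  { case 1 show ?case by (simp add: nim_sum_empty) }
  { case 2 show ?case by (simp add: nim_sum_empty) }
next
  case (insert a A)
  { case 1 show ?case using insert by (auto simp: nim_sum_insert even_xor_iff) }
  { case 2 show ?case
      using insert bit_Suc_nat_1[of "y a"] by (auto simp: nim_sum_insert even_xor_iff bit_xor_iff) }
qed

text \<open>Without carries, adding one is \<open>xor\<close> with 1, and these ones cancel in
  pairs.\<close>

lemma nim_sum_Suc_of_even:
  assumes "finite A" "\<And>a. a \<in> A \<Longrightarrow> even (y a)"
  shows "nim_sum (\<lambda>a. Suc (y a)) A = xor (nim_sum y A) (card A mod 2)"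
  using assms
proof (induction A)
  case empty
  then show ?case by (simp add: nim_sum_empty)
next
  case (insert a A)
  have "Suc (y a) = xor (y a) 1"
    using insert.prems by (simp add: xor_Suc_0_eq)
  moreover have "Suc (card A) mod 2 = xor 1 (card A mod 2)"
    by (cases "even (card A)") (auto simp: mod_2_eq_odd)
  ultimately show ?case
    using insert by (simp add: nim_sum_insert ac_simps)
qed

lemma ex_bit_nim_sum:
  assumes "finite A" "bit (nim_sum y A) h"
  shows "\<exists>a\<in>A. bit (y a) h"
  using assms by (induction A) (auto simp: nim_sum_empty nim_sum_insert bit_xor_iff)

text \<open>The equation says at once that bit \<open>h\<close> is set and that no higher bit
  is.\<close>

lemma ex_leading_bit:
  fixes d :: nat
  assumes "d \<noteq> 0"
  shows "\<exists>h. drop_bit h d = 1"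
  using assms
proof (induction d rule: less_induct)
  case (less d)
  show ?case
  proof (cases "d = 1")
    case True
    then have "drop_bit 0 d = 1" by simp
    then show ?thesis ..
  next
    case False
    with less.prems have "d div 2 < d" "d div 2 \<noteq> 0" by auto
    with less.IH obtain h where "drop_bit h (d div 2) = 1" by blast
    then have "drop_bit (Suc h) d = 1" by (simp add: drop_bit_Suc)
    then show ?thesis ..
  qed
qed

text \<open>The bits of \<open>y\<close> above \<open>h\<close> stay and bit \<open>h\<close> is
  cleared, so the lower bits cannot matter.\<close>

lemma xor_less_self:
  fixes d y :: nat
  assumes "drop_bit h d = 1" "bit y h"
  shows "xor y d < y"
proof -
  have "odd (drop_bit h y)"
    using assms(2) by (simp add: bit_iff_odd_drop_bit)
  then have "drop_bit h (xor y d) < drop_bit h y"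
    using assms(1) by (simp add: xor_Suc_0_eq odd_pos)
  then show ?thesis
    by (metis div_le_mono drop_bit_eq_div linorder_not_less)
qed

text \<open>At the highest bit where two numbers differ, the larger one has the 1.\<close>

lemma bit_of_leading_xor:
  fixes s t :: nat
  assumes "t < s" "drop_bit h (xor s t) = 1"
  shows "bit s h"
proof (rule ccontr)
  assume "\<not> bit s h"
  then have "even (drop_bit h s)"
    by (simp add: bit_iff_odd_drop_bit)
  moreover have "drop_bit h t = xor (drop_bit h s) 1"
    using assms(2) by (metis drop_bit_xor xor.assoc xor_self_eq xor.left_neutral)
  ultimately have "drop_bit h s < drop_bit h t"
    by (simp add: xor_Suc_0_eq)
  then show False
    using assms(1) by (metis div_le_mono drop_bit_eq_div less_imp_le linorder_not_less)
qed

text \<open>Bouton's argument with target \<open>t\<close> instead of 0: some heap contains the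
  leading bit of \<open>?d\<close>, and its \<open>xor\<close> with \<open>?d\<close> is
  smaller.\<close>

lemma ex_nim_move:
  assumes "finite A" "t < nim_sum y A"
  shows "\<exists>a\<in>A. \<exists>n<y a. nim_sum (y(a := n)) A = t"
proof -
  let ?d = "xor (nim_sum y A) t"
  have "?d \<noteq> 0"
    using assms(2) by (metis less_irrefl xor.assoc xor_self_eq xor.left_neutral xor.right_neutral)
  then obtain h where h: "drop_bit h ?d = 1"
    using ex_leading_bit by blast
  then obtain a where a: "a \<in> A" "bit (y a) h"
    using ex_bit_nim_sum[OF assms(1)] bit_of_leading_xor[OF assms(2)] by blast
  have "nim_sum (y(a := xor (y a) ?d)) A = t"
    unfolding nim_sum_update[OF assms(1) a(1)] by (auto simp: bit_eq_iff bit_xor_iff)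
  with a xor_less_self[OF h] show ?thesis
    by blast
qed

text \<open>Here the nim-sum has to grow, which \<open>ex_nim_move\<close> does not cover;
  decrementing an odd heap flips only bit 0.\<close>

lemma nim_move_zero_to_one:
  assumes "finite A" "nim_sum y A = 0" "a \<in> A" "odd (y a)"
  shows "\<exists>n<y a. nim_sum (y(a := n)) A = 1"
proof (intro exI conjI)
  show "y a - 1 < y a"
    using assms(4) by (simp add: odd_pos)
  have "y a - 1 = xor (y a) 1"
    using assms(4) by (simp add: xor_Suc_0_eq)
  then show "nim_sum (y(a := y a - 1)) A = 1"
    using assms by (simp only: nim_sum_update) (simp flip: xor.assoc)
qed

section \<open>Digraph Yama Nim\<close>

lemma yama_move_on_positions:
  "\<forall>p\<in>positions U. \<forall>q. yama_move_on G U p q \<longrightarrow> q \<in> positions U"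
  by (auto simp: yama_move_on_def)

lemma out_arcs_with_proj: "out_arcs (with_proj G) v = {e \<in> parcs G. fst e = v}"
  by (auto simp: out_arcs_def)

text \<open>Arcs are pairs, so \<open>Pair v\<close> embeds the out-neighbours into the out-arcs;
  some of these may end outside \<open>U\<close>.\<close>

lemma card_out_neighbours_le:
  assumes "pair_fin_digraph G"
  shows "card {u \<in> U. (v, u) \<in> parcs G} \<le> out_degree (with_proj G) v"
  unfolding out_degree_def out_arcs_with_proj
proof (rule card_inj_on_le)
  show "finite {e \<in> parcs G. fst e = v}"
    using pair_fin_digraph.pair_finite_arcs[OF assms] by simp
qed (auto intro!: inj_onI[of _ "Pair v"])

text \<open>The number of tokens on \<open>U\<close> drops: at most the out-degree is added, loops
  included, and at least one more is removed.\<close>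

lemma wf_yama_move_on:
  assumes G: "pair_fin_digraph G" and U: "finite U"
  shows "wf {(q, p). yama_move_on G U p q}"
proof (rule wf_subset[OF wf_measure[of "\<lambda>p. sum p U"]], clarsimp)
  fix p q assume "yama_move_on G U p q"
  then obtain v k where v: "v \<in> U" and k: "out_degree (with_proj G) v + 1 \<le> k" "k \<le> p v"
    and q: "q = (\<lambda>u\<in>U. (if u = v then p u - k else p u) + (if (v, u) \<in> parcs G then 1 else 0))"
    unfolding yama_move_on_def by blast
  have "sum q U = (\<Sum>u\<in>U. if u = v then p u - k else p u) + card {u \<in> U. (v, u) \<in> parcs G}"
    using U by (simp add: q sum.distrib sum.If_cases Int_def)
  also have "(\<Sum>u\<in>U. if u = v then p u - k else p u) = (p v - k) + sum p (U - {v})"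
    using U v by (subst sum.remove[of _ v]) (auto intro: sum.cong)
  finally show "sum q U < sum p U"
    using sum.remove[OF U v, of p] card_out_neighbours_le[OF G, of U v] k by linarith
qed

theorem theorem9:
  fixes G :: "'a pair_pre_digraph" and V1 W1 :: "'a set"
  assumes "pair_fin_digraph G"
    and "pverts G = V1 \<union> W1" and "V1 \<inter> W1 = {}"
    and "\<And>v w. v \<in> V1 \<Longrightarrow> w \<in> W1 \<Longrightarrow> (v, w) \<in> parcs G"
    and "\<And>w. w \<in> W1 \<Longrightarrow> out_degree (with_proj G) w = 0"
    and "even (card W1)"
  defines "S_P \<equiv> P_positions (positions V1) (yama_move_on G V1)"
    and "S_N \<equiv> N_positions (positions V1) (yama_move_on G V1)"
  shows "P_positions (positions (pverts G)) (yama_move G) =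
      {p \<in> positions (pverts G). restrict p V1 \<in> S_P \<and> nim_sum p W1 = 0}
    \<union> {p \<in> positions (pverts G). restrict p V1 \<in> S_N \<and> nim_sum p W1 = 1}"
    (is "_ = ?K")
proof -
  note V = assms(2) and disj = assms(3) and edge = assms(4)
  have fin: "finite V1" "finite W1"
    using pair_fin_digraph.pair_finite_verts[OF assms(1)] V by auto
  have sink: "(w, u) \<notin> parcs G" if "w \<in> W1" for w u
    \<comment> \<open>Taking \<open>{u}\<close> for \<open>U\<close> turns out-degree 0 into the
      absence of the single arc.\<close>
    using card_out_neighbours_le[OF assms(1), of "{u}" w] assms(5)[OF that]
    by (auto split: if_splits simp: card_eq_0_iff)
  note wf = wf_yama_move_on[OF assms(1) fin(1)]
  obtain K where K: "is_kernel (positions V1) (yama_move_on G V1) K"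
    using ex_kernel[OF wf yama_move_on_positions] by blast
  have S_P: "S_P = K"
    unfolding S_P_def by (rule P_positions_kernel[OF wf yama_move_on_positions K])
  have S_N: "S_N = positions V1 - K"
    unfolding S_N_def by (rule N_positions_kernel[OF wf yama_move_on_positions K])
  have res: "restrict p V1 \<in> positions V1" for p :: "'a \<Rightarrow> nat"
    by simp
  have move_cases:
    "yama_move_on G V1 (restrict p V1) (restrict q V1) \<and>
       nim_sum q W1 = nim_sum (\<lambda>w. Suc (p w)) W1 \<or>
     restrict q V1 = restrict p V1 \<and> nim_sum q W1 \<noteq> nim_sum p W1"
    if move: "yama_move G p q" for p q
  proof -
    obtain v k where v: "v \<in> V1 \<union> W1" and k: "out_degree (with_proj G) v + 1 \<le> k" "k \<le> p v"
      and q: "q = (\<lambda>u\<in>V1 \<union> W1.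
        (if u = v then p u - k else p u) + (if (v, u) \<in> parcs G then 1 else 0))"
      using move unfolding yama_move_def yama_move_on_def V by blast
    show ?thesis
    proof (cases "v \<in> V1")
      case True
      have "yama_move_on G V1 (restrict p V1) (restrict q V1)"
        unfolding yama_move_on_def using True k
          by (auto simp: q fun_eq_iff intro!: bexI[of _ v] exI[of _ k])
      moreover have "nim_sum q W1 = nim_sum (\<lambda>w. Suc (p w)) W1"
        by (rule nim_sum_cong) (use True edge disj in \<open>auto simp: q\<close>)
      ultimately show ?thesis
        by blast
    next
      case False
      with v have w: "v \<in> W1" by blast
      have "restrict q V1 = restrict p V1"
        using False sink[OF w] by (auto simp: q fun_eq_iff)
      moreover have "nim_sum q W1 = nim_sum (p(v := p v - k)) W1"
        by (rule nim_sum_cong) (use sink[OF w] in \<open>auto simp: q\<close>)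
      moreover have "p v - k \<noteq> p v"
        using k by simp
      ultimately show ?thesis
        using nim_sum_update_neq[where y = p, OF fin(2) w] by metis
    qed
  qed
  \<comment> \<open>Auxiliary moves lift, because both games measure the out-degree in all of
    \<open>G\<close>.\<close>
  have V_move: "\<exists>q. yama_move G p q \<and> restrict q V1 = x \<and> nim_sum q W1 = nim_sum (\<lambda>w. Suc (p w)) W1"
    if move: "yama_move_on G V1 (restrict p V1) x" for p x
  proof -
    obtain v k where v: "v \<in> V1" and k: "out_degree (with_proj G) v + 1 \<le> k" "k \<le> p v"
      and x: "x = (\<lambda>u\<in>V1. (if u = v then restrict p V1 u - k else restrict p V1 u)
        + (if (v, u) \<in> parcs G then 1 else 0))"
      using move unfolding yama_move_on_def by auto
    define q where "q = (\<lambda>u\<in>V1 \<union> W1.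
      (if u = v then p u - k else p u) + (if (v, u) \<in> parcs G then 1 else 0))"
    have "yama_move G p q"
      unfolding yama_move_def yama_move_on_def V q_def using v k by blast
    moreover have "restrict q V1 = x"
      by (auto simp: q_def x fun_eq_iff)
    moreover have "nim_sum q W1 = nim_sum (\<lambda>w. Suc (p w)) W1"
      by (rule nim_sum_cong) (use v edge disj in \<open>auto simp: q_def\<close>)
    ultimately show ?thesis
      by blast
  qed
  have W_move: "\<exists>q. yama_move G p q \<and> restrict q V1 = restrict p V1 \<and>
      nim_sum q W1 = nim_sum (p(w := n)) W1"
    if w: "w \<in> W1" and n: "n < p w" for p w n
  proof -
    define q where "q = (\<lambda>u\<in>V1 \<union> W1.
      (if u = w then p u - (p w - n) else p u) + (if (w, u) \<in> parcs G then 1 else 0))"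
    \<comment> \<open>A sink is an ordinary Nim heap: any positive number of tokens may be
      removed.\<close>
    have "out_degree (with_proj G) w + 1 \<le> p w - n" "p w - n \<le> p w"
      using assms(5)[OF w] n by auto
    then have "yama_move G p q"
      unfolding yama_move_def yama_move_on_def V q_def using w by blast
    moreover have "restrict q V1 = restrict p V1"
      using w disj sink[OF w] by (auto simp: q_def fun_eq_iff)
    moreover have "nim_sum q W1 = nim_sum (p(w := n)) W1"
      by (rule nim_sum_cong) (use n sink[OF w] in \<open>auto simp: q_def\<close>)
    ultimately show ?thesis
      by blast
  qed
  have parity: "even (nim_sum (\<lambda>w. Suc (p w)) W1) \<longleftrightarrow> even (nim_sum p W1)" for p
    using nim_sum_Suc_low_bits(1)[OF fin(2)] assms(6) by simp
  have closed: "\<forall>p\<in>positions (pverts G). \<forall>q.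
      yama_move G p q \<longrightarrow> q \<in> positions (pverts G)"
    unfolding yama_move_def by (rule yama_move_on_positions)
  let ?K' = "{p \<in> positions (pverts G). restrict p V1 \<in> K \<and> nim_sum p W1 = 0}
    \<union> {p \<in> positions (pverts G). restrict p V1 \<in> positions V1 - K \<and> nim_sum p W1 = 1}"
  have "is_kernel (positions (pverts G)) (yama_move G) ?K'"
    unfolding is_kernel_def
  proof (intro conjI ballI allI impI)
    fix p q
    assume p: "p \<in> ?K'" and move: "yama_move G p q"
    from move_cases[OF move] show "q \<notin> ?K'"
    proof (elim disjE conjE)
      assume x: "yama_move_on G V1 (restrict p V1) (restrict q V1)"
        and y: "nim_sum q W1 = nim_sum (\<lambda>w. Suc (p w)) W1"
      show ?thesis
      proof (cases "restrict p V1 \<in> K")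
        case True
        then have "restrict q V1 \<notin> K" "even (nim_sum q W1)"
          using K x y p parity[of p] by (auto simp: is_kernel_def)
        then show ?thesis
          by auto
      next
        case False
        then have "nim_sum p W1 = 1"
          using p by auto
        then have "bit (nim_sum q W1) 1"
          using nim_sum_Suc_low_bits(2)[OF fin(2), of p] y by (simp add: bit_1_iff)
        then have "nim_sum q W1 \<notin> {0, 1}"
          by (intro notI) (auto simp: bit_iff_odd)
        then show ?thesis
          by auto
      qed
    \<comment> \<open>A move inside \<open>W1\<close> keeps the \<open>V1\<close> part, hence the
      required nim-sum, but changes the actual one.\<close>
    qed (use p in auto)
  next
    fix p
    assume pos: "p \<in> positions (pverts G) - ?K'"
    then have p: "restrict p V1 \<in> K \<Longrightarrow> nim_sum p W1 \<noteq> 0"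
      "restrict p V1 \<notin> K \<Longrightarrow> nim_sum p W1 \<noteq> 1"
      using res[of p] by auto
    \<comment> \<open>The conditional merges the two halves of \<open>?K'\<close>.\<close>
    have "\<exists>q. yama_move G p q \<and> (if restrict q V1 \<in> K then nim_sum q W1 = 0 else nim_sum q W1 = 1)"
    proof (cases "restrict p V1 \<in> K")
      case True
      then obtain w n where w: "w \<in> W1" "n < p w" "nim_sum (p(w := n)) W1 = 0"
        using ex_nim_move[OF fin(2), of 0 p] p(1) by auto
      with W_move[where p = p, OF w(1,2)] True show ?thesis
        by auto
    next
      case False
      show ?thesis
      \<comment> \<open>This is exactly when no move inside \<open>W1\<close> reaches nim-sum 1: an
        even heap would have to grow by one.\<close>
      proof (cases "nim_sum p W1 = 0 \<and> (\<forall>w\<in>W1. even (p w))")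
        case True
        obtain x where x: "x \<in> K" "yama_move_on G V1 (restrict p V1) x"
          using K False res[of p] unfolding is_kernel_def by blast
        have "nim_sum (\<lambda>w. Suc (p w)) W1 = 0"
          using nim_sum_Suc_of_even[OF fin(2), of p] True assms(6) by simp
        with V_move[OF x(2)] x(1) show ?thesis
          by auto
      next
        case not_even: False
        have "\<exists>w\<in>W1. \<exists>n<p w. nim_sum (p(w := n)) W1 = 1"
        proof (cases "nim_sum p W1 = 0")
          case True
          with not_even show ?thesis
            using nim_move_zero_to_one[OF fin(2) True] by blast
        next
          case nz: False
          with p(2) False have "1 < nim_sum p W1"
            by simp
          then show ?thesis
            by (rule ex_nim_move[OF fin(2)])
        qed
        then obtain w n where w: "w \<in> W1" "n < p w" "nim_sum (p(w := n)) W1 = 1"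
          by blast
        with W_move[where p = p, OF w(1,2)] False show ?thesis
          by auto
      qed
    qed
    then obtain q where q: "yama_move G p q"
      "if restrict q V1 \<in> K then nim_sum q W1 = 0 else nim_sum q W1 = 1"
      by blast
    moreover have "q \<in> positions (pverts G)"
      using closed pos q(1) by blast
    ultimately have "q \<in> ?K'"
      using res[of q] by (cases "restrict q V1 \<in> K") simp_all
    with q(1) show "\<exists>q\<in>?K'. yama_move G p q"
      by blast
  qed auto
  moreover have "wf {(q, p). yama_move G p q}"
    using wf_yama_move_on[OF assms(1)] fin V unfolding yama_move_def by simp
  ultimately show ?thesis
    using P_positions_kernel[OF _ closed] by (simp add: S_P S_N)
qed

end
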